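(* Let $W_0, W_1, W_2$ be complex Hermitian vector spaces with real structures, and let $L_{01} \subset W_0 \oplus -W_1$ and $L_{12} \subset W_1 \oplus -W_2$ be Lagrangians. Assume that $W_0, W_1, W_2$ are complete. Put $W = W_0 \oplus -W_1 \oplus W_1 \oplus -W_2$, $L = L_{01}\oplus L_{12}\subset W$, $U = \{(0,w,w,0)\in W \mid w\in W_1\}$, and let $\sigma : W \to W_1$ be $\sigma(v_0,v_1,v_1',v_2) = v_1 - v_1'$. Let $P_L$ and $P_{\overline{L}}$ denote the orthogonal projections of $W$ onto $L$ and onto $\overline{L}$. Then the following statements are equivalent: (i) The map $\sigma$ has closed range when restricted to $L$. (ii) The subspaces $P_L\overline{U}$ and $P_{\overline{L}}U$ are closed. Moreover, when these equivalent statements hold, the composition $L_{02} = L_{01}\circ L_{12}$ is a Lagrangian in $W_0\oplus -W_2$.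
   Context: Hermitian forms are $\mathbb{C}$-antilinear in the first entry (and positive definite). A real structure on a Hermitian vector space $V$ is an anti-unitary involution $v\mapsto \overline{v}$. The opposite $-V$ is the same Hermitian vector space with real structure $v\mapsto -\overline{v}$. For a subset $S\subset V$, $\overline{S}=\{\overline{s}\mid s\in S\}$. Direct sums are orthogonal and carry the direct sum real structure; thus on $W = W_0 \oplus -W_1 \oplus W_1 \oplus -W_2$ the real structure is $\overline{(v_0,v_1,v_1',v_2)} = (\overline{v}_0,-\overline{v}_1,\overline{v}_1',-\overline{v}_2)$, and so $\overline{U}=\{(0,-w,w,0)\mid w\in W_1\}$. A complex subspace $L\subset V$ is called Lagrangian if $\overline{L} = L^\perp$, where $\perp$ denotes the orthogonal complement with respect to the Hermitian form. The composition of Lagrangians $L_{01}\subset W_0\oplus -W_1$ and $L_{12}\subset W_1\oplus -W_2$ is $$L_{01}\circ L_{12} = \{(w_0,w_2)\in W_0\oplus -W_2 \mid \exists\, w_1\in W_1: (w_0,w_1)\in L_{01},\ (w_1,w_2)\in L_{12}\}.$$ *)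

theory Defs
  imports "HOL-Analysis.Analysis"
begin

text \<open>
  Complex Hermitian vector spaces.  The form \<^term>\<open>cinner\<close> is antilinear in its first entry
  (this follows from symmetry and linearity in the second one); its positive definiteness is
  inherited from \<^class>\<open>real_inner\<close> through \<open>inner_eq_Re_cinner\<close>, which also makes norm and
  topology those induced by the Hermitian form.
\<close>

class hermitian_space = real_inner +
  fixes scaleC :: "complex \<Rightarrow> 'a \<Rightarrow> 'a" (infixr "*\<^sub>C" 75)
    and cinner :: "'a \<Rightarrow> 'a \<Rightarrow> complex"
  assumes scaleC_add_right: "a *\<^sub>C (x + y) = a *\<^sub>C x + a *\<^sub>C y"
    and scaleC_add_left: "(a + b) *\<^sub>C x = a *\<^sub>C x + b *\<^sub>C x"
    and scaleC_scaleC: "a *\<^sub>C b *\<^sub>C x = (a * b) *\<^sub>C x"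
    and scaleC_one: "1 *\<^sub>C x = x"
    and scaleR_eq_scaleC: "r *\<^sub>R x = complex_of_real r *\<^sub>C x"
    and cinner_commute: "cinner x y = cnj (cinner y x)"
    and cinner_add_right: "cinner x (y + z) = cinner x y + cinner x z"
    and cinner_scaleC_right: "cinner x (a *\<^sub>C y) = a * cinner x y"
    and inner_eq_Re_cinner: "inner x y = Re (cinner x y)"

global_interpretation complex_vector:
  vector_space "scaleC :: complex \<Rightarrow> 'a \<Rightarrow> 'a::hermitian_space"
  defines csubspace = complex_vector.subspace
  by unfold_locales (rule scaleC_add_right scaleC_add_left scaleC_scaleC scaleC_one)+

lemma cinner_add_left: "cinner (x + y) z = cinner x z + cinner y z"
  by (metis cinner_add_right cinner_commute complex_cnj_add)

lemma cinner_scaleC_left: "cinner (a *\<^sub>C x) y = cnj a * cinner x y"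
  by (metis cinner_commute cinner_scaleC_right complex_cnj_mult)

lemma cinner_self_eq_norm: "cinner x x = complex_of_real ((norm x)\<^sup>2)"
proof (rule complex_eqI)
  show "Re (cinner x x) = Re (complex_of_real ((norm x)\<^sup>2))"
    by (simp add: power2_norm_eq_inner inner_eq_Re_cinner)
  have "Im (cinner x x) = Im (cnj (cinner x x))"
    using cinner_commute[of x x] by simp
  then show "Im (cinner x x) = Im (complex_of_real ((norm x)\<^sup>2))"
    by simp
qed

lemma cinner_minus_right: "cinner x (- y) = - cinner x y"
proof -
  have "cinner x (0 + 0) = cinner x 0 + cinner x 0" by (rule cinner_add_right)
  then have "cinner x (y + - y) = 0" by simp
  then show ?thesis by (simp only: cinner_add_right add_eq_0_iff)
qed

lemma cinner_minus_left: "cinner (- x) y = - cinner x y"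
  by (metis cinner_commute cinner_minus_right complex_cnj_minus)

text \<open>Direct sums are orthogonal.\<close>

instantiation prod :: (hermitian_space, hermitian_space) hermitian_space
begin

definition "a *\<^sub>C x = (a *\<^sub>C fst x, a *\<^sub>C snd x)"

definition "cinner x y = cinner (fst x) (fst y) + cinner (snd x) (snd y)"

instance
proof
  fix x y z :: "'a \<times> 'b" and a b :: complex and r :: real
  show "a *\<^sub>C (x + y) = a *\<^sub>C x + a *\<^sub>C y"
    by (simp add: scaleC_prod_def scaleC_add_right)
  show "(a + b) *\<^sub>C x = a *\<^sub>C x + b *\<^sub>C x"
    by (simp add: scaleC_prod_def scaleC_add_left)
  show "a *\<^sub>C b *\<^sub>C x = (a * b) *\<^sub>C x"
    by (simp add: scaleC_prod_def scaleC_scaleC)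
  show "1 *\<^sub>C x = x"
    by (simp add: scaleC_prod_def scaleC_one)
  show "r *\<^sub>R x = complex_of_real r *\<^sub>C x"
    by (simp add: scaleC_prod_def scaleR_prod_def scaleR_eq_scaleC)
  show "cinner x y = cnj (cinner y x)"
    unfolding cinner_prod_def complex_cnj_add by (simp flip: cinner_commute)
  show "cinner x (y + z) = cinner x y + cinner x z"
    by (simp add: cinner_prod_def cinner_add_right)
  show "cinner x (a *\<^sub>C y) = a * cinner x y"
    by (simp add: cinner_prod_def scaleC_prod_def cinner_scaleC_right distrib_left)
  show "inner x y = Re (cinner x y)"
    by (simp add: cinner_prod_def inner_prod_def inner_eq_Re_cinner)
qed

end

text \<open>
  A space carries several real structures (those of \<open>V\<close> and of \<open>-V\<close>), so a real structure is
  an explicit map rather than part of the type class.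
\<close>

definition real_structure :: "('a::hermitian_space \<Rightarrow> 'a) \<Rightarrow> bool" where
  "real_structure c \<longleftrightarrow>
     (\<forall>v w. c (v + w) = c v + c w) \<and>
     (\<forall>a v. c (a *\<^sub>C v) = cnj a *\<^sub>C c v) \<and>
     (\<forall>v w. cinner (c v) (c w) = cnj (cinner v w)) \<and>
     (\<forall>v. c (c v) = v)"

definition opposite :: "('a::hermitian_space \<Rightarrow> 'a) \<Rightarrow> ('a \<Rightarrow> 'a)" where
  "opposite c = (\<lambda>v. - c v)"

text \<open>The direct sum of real structures is \<^const>\<open>map_prod\<close>.\<close>

lemma real_structure_opposite:
  "real_structure c \<Longrightarrow> real_structure (opposite c)"
proof -
  assume c: "real_structure c"
  have "c (- v) = - c v" for v
  proof -
    have "c (0 + 0) = c 0 + c 0" using c unfolding real_structure_def by blast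
    then have "c (v + - v) = 0" by simp
    moreover have "c (v + - v) = c v + c (- v)" using c unfolding real_structure_def by blast
    ultimately show ?thesis by (simp add: add_eq_0_iff)
  qed
  then show ?thesis
    using c by (simp add: real_structure_def opposite_def cinner_minus_left cinner_minus_right)
qed

lemma real_structure_map_prod:
  "real_structure c \<Longrightarrow> real_structure d \<Longrightarrow> real_structure (map_prod c d)"
  by (simp add: real_structure_def scaleC_prod_def cinner_prod_def split_paired_all)

definition cperp :: "'a::hermitian_space set \<Rightarrow> 'a set" where
  "cperp S = {v. \<forall>s\<in>S. cinner s v = 0}"

definition lagrangian :: "('a::hermitian_space \<Rightarrow> 'a) \<Rightarrow> 'a set \<Rightarrow> bool" where
  "lagrangian c L \<longleftrightarrow> csubspace L \<and> c ` L = cperp L"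

text \<open>Meaningful only where the projection exists, e.g. for closed \<open>M\<close> in a complete space.\<close>

definition orth_proj :: "'a::hermitian_space set \<Rightarrow> 'a \<Rightarrow> 'a" where
  "orth_proj M v = (THE p. p \<in> M \<and> v - p \<in> cperp M)"

end

theory Submission
  imports Defs
begin

text \<open>
  Let \<open>\<tau> w = (0, w, -w, 0)\<close>, the adjoint of \<open>\<sigma>\<close>, so that the conjugate of \<open>U\<close> is the range of \<open>\<tau>\<close>.
  The operator \<open>T = \<sigma> P\<^sub>L\<close> on \<open>W\<close> then has range \<open>\<sigma> L\<close>, and its adjoint \<open>S = P\<^sub>L \<tau>\<close> has as range the
  projection of the conjugate of \<open>U\<close> to \<open>L\<close>. Hence the equivalence is the closed range theorem
  (\<open>closed_range_adjoint\<close>) for the pair \<open>T\<close>, \<open>S\<close>, used in both directions. The second subspace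
  in (ii) is the image of the first one under the real structure, which is a homeomorphism.

  The composition is the image of \<open>L \<inter> ker \<sigma>\<close> under \<open>(w\<^sub>0, w\<^sub>1, w\<^sub>1, w\<^sub>2) \<mapsto> (w\<^sub>0, w\<^sub>2)\<close>. It is always
  isotropic, because the two contributions of \<open>W\<^sub>1\<close> cancel (\<open>relcomp_isotropic\<close>). Conversely, let
  \<open>(x\<^sub>0, x\<^sub>2)\<close> be orthogonal to the composition. Then \<open>P\<^sub>L (x\<^sub>0, 0, 0, x\<^sub>2)\<close> is orthogonal to the
  kernel of \<open>T\<close>. In general it would only lie in the closure of the range of \<open>S\<close>; since that range
  is closed, it equals \<open>P\<^sub>L (\<tau> w)\<close> for some \<open>w\<close>
  (\<open>orthogonal_kernel_in_closed_range_adjoint\<close>). So \<open>(x\<^sub>0, -w, w, x\<^sub>2)\<close> is orthogonal to \<open>L\<close>, its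
  conjugate lies in \<open>L\<close> because \<open>L\<close> is Lagrangian, and the two middle entries of this conjugate
  agree: the conjugate of \<open>(x\<^sub>0, x\<^sub>2)\<close> is in the composition.

  The Hermitian form has the same orthogonal complement of a complex subspace as its real part
  (\<open>cperp_eq_inner\<close>), so all the functional analysis is done over the reals.
\<close>

section \<open>Closed ranges in real Hilbert spaces\<close>

lemma orthogonal_projection_exists:
  fixes M :: "'a::real_inner set"
  assumes M: "subspace M" "complete M"
  shows "\<exists>p\<in>M. \<forall>m\<in>M. inner (x - p) m = 0"
proof -
  define \<delta> where "\<delta> = (INF m\<in>M. (norm (x - m))\<^sup>2)"
  have M0: "0 \<in> M" using M(1) by (rule subspace_0)
  have bdd: "bdd_below ((\<lambda>m. (norm (x - m))\<^sup>2) ` M)"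
    by (rule bdd_belowI[of _ 0]) auto
  have \<delta>_le: "\<delta> \<le> (norm (x - m))\<^sup>2" if "m \<in> M" for m
    unfolding \<delta>_def using bdd that by (rule cINF_lower)
  have "\<exists>m\<in>M. (norm (x - m))\<^sup>2 < \<delta> + inverse (real (Suc n))" for n
  proof (rule ccontr)
    assume "\<not> ?thesis"
    then have "\<delta> + inverse (real (Suc n)) \<le> (INF m\<in>M. (norm (x - m))\<^sup>2)"
      using M0 by (intro cINF_greatest) (auto simp: not_less)
    then show False
      by (simp add: \<delta>_def)
  qed
  then obtain m where mM: "\<And>n. m n \<in> M"
    and m: "\<And>n. (norm (x - m n))\<^sup>2 < \<delta> + inverse (real (Suc n))"
    by metis
  \<comment> \<open>By the parallelogram law, applied to the midpoint of two terms, a minimising sequence is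
    Cauchy.\<close>
  have close: "(norm (m i - m j))\<^sup>2 < 2 * inverse (real (Suc i)) + 2 * inverse (real (Suc j))" for i j
  proof -
    have mid: "(1/2) *\<^sub>R (m i + m j) \<in> M"
      using M(1) mM by (simp add: subspace_add subspace_scale)
    have parallelogram: "(norm (u - v))\<^sup>2 = 2 * (norm u)\<^sup>2 + 2 * (norm v)\<^sup>2 - (norm (u + v))\<^sup>2"
      for u v :: 'a
      unfolding power2_norm_eq_inner inner_diff_left inner_diff_right inner_add_left inner_add_right
      by simp
    have "(x - m j) + (x - m i) = 2 *\<^sub>R (x - (1/2) *\<^sub>R (m i + m j))"
      by (simp add: algebra_simps scaleR_2)
    then have "(norm (m i - m j))\<^sup>2 = 2 * (norm (x - m j))\<^sup>2 + 2 * (norm (x - m i))\<^sup>2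
        - 4 * (norm (x - (1/2) *\<^sub>R (m i + m j)))\<^sup>2"
      using parallelogram[of "x - m j" "x - m i"] by (simp add: power_mult_distrib)
    then show ?thesis
      using \<delta>_le[OF mid] m[of i] m[of j] by linarith
  qed
  have "Cauchy m"
  proof (rule CauchyI)
    fix e :: real assume "e > 0"
    then obtain N where N: "inverse (real (Suc N)) < e\<^sup>2 / 4"
      using reals_Archimedean[of "e\<^sup>2 / 4"] by auto
    show "\<exists>N. \<forall>i\<ge>N. \<forall>j\<ge>N. norm (m i - m j) < e"
    proof (intro exI[of _ N] allI impI)
      fix i j assume "i \<ge> N" "j \<ge> N"
      then have "inverse (real (Suc i)) \<le> inverse (real (Suc N))"
        "inverse (real (Suc j)) \<le> inverse (real (Suc N))"
        by (auto intro!: le_imp_inverse_le)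
      with close[of i j] N have "(norm (m i - m j))\<^sup>2 < e\<^sup>2" by linarith
      with \<open>e > 0\<close> show "norm (m i - m j) < e"
        by (meson less_imp_le power_less_imp_less_base)
    qed
  qed
  with M(2) mM obtain p where pM: "p \<in> M" and lim: "m \<longlonglongrightarrow> p"
    unfolding complete_def by blast
  have min_p: "(norm (x - p))\<^sup>2 \<le> \<delta>"
  proof (rule LIMSEQ_le)
    show "(\<lambda>n. (norm (x - m n))\<^sup>2) \<longlonglongrightarrow> (norm (x - p))\<^sup>2"
      by (intro tendsto_intros lim)
    show "(\<lambda>n. \<delta> + inverse (real (Suc n))) \<longlonglongrightarrow> \<delta>"
      using tendsto_add[OF tendsto_const[of \<delta>] LIMSEQ_inverse_real_of_nat] by simp
    show "\<exists>N. \<forall>n\<ge>N. (norm (x - m n))\<^sup>2 \<le> \<delta> + inverse (real (Suc n))"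
      using m less_imp_le by blast
  qed
  have "inner (x - p) k = 0" if k: "k \<in> M" for k
  proof (cases "k = 0")
    case False
    \<comment> \<open>The value of \<open>t\<close> that minimises the distance from \<open>x\<close> to \<open>p + t *\<^sub>R k\<close>.\<close>
    define t where "t = inner (x - p) k / inner k k"
    have kk: "inner k k > 0" using False by simp
    then have tk: "t * inner k k = inner (x - p) k" by (simp add: t_def)
    have "p + t *\<^sub>R k \<in> M"
      using M(1) pM k by (simp add: subspace_add subspace_scale)
    then have "(norm (x - p))\<^sup>2 \<le> (norm (x - (p + t *\<^sub>R k)))\<^sup>2"
      using \<delta>_le min_p order_trans by blast
    also have "x - (p + t *\<^sub>R k) = (x - p) - t *\<^sub>R k" by simp
    also have "(norm ((x - p) - t *\<^sub>R k))\<^sup>2 = (norm (x - p))\<^sup>2 - 2 * (t * inner (x - p) k) + t * (t * inner k k)"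
      unfolding power2_norm_eq_inner inner_diff_left[of "x - p"] inner_diff_right[of _ "x - p"]
      by (simp add: inner_commute[of k "x - p"])
    finally have "t * inner (x - p) k \<le> 0"
      using tk by simp
    then have "t * t * inner k k \<le> 0"
      using tk by (simp add: mult.assoc)
    then have "t = 0"
      using kk by (auto simp: mult_le_0_iff)
    with tk show ?thesis by simp
  qed simp
  with pM show ?thesis by blast
qed

text \<open>
  The uniform boundedness principle for functionals represented by vectors. By the Baire category
  theorem the functionals are uniformly bounded on some ball, and moving from its centre towards
  \<open>y\<close> by the radius changes the value of the functional of \<open>y\<close> by the radius times the norm
  of \<open>y\<close>.
\<close>
lemma uniform_boundedness_inner:
  fixes F :: "'a::{real_inner, complete_space} set"
  assumes "\<And>z. \<exists>B. \<forall>y\<in>F. \<bar>inner z y\<bar> \<le> B"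
  shows "bounded F"
proof -
  define E where "E n = {z. \<forall>y\<in>F. \<bar>inner z y\<bar> \<le> real n}" for n
  have closed_E: "closed (E n)" for n
    unfolding E_def Ball_def
    by (intro closed_Collect_all closed_Collect_imp open_Collect_const closed_Collect_le
        continuous_intros)
  have UN_E: "(\<Union>n. E n) = UNIV"
  proof -
    have "\<exists>n. z \<in> E n" for z
    proof -
      obtain B where B: "\<And>y. y \<in> F \<Longrightarrow> \<bar>inner z y\<bar> \<le> B" using assms by blast
      obtain n where "B \<le> real n" using real_arch_simple by blast
      then have "z \<in> E n" using B unfolding E_def by (auto intro: order_trans)
      then show ?thesis ..
    qed
    then show ?thesis by blast
  qed
  have "\<exists>n. interior (E n) \<noteq> {}"
  proof (rule ccontr)
    assume "\<not> ?thesis"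
    then have "euclidean interior_of \<Union>(range E) = {}"
      by (intro Baire_category_alt) (auto simp: completely_metrizable_space_euclidean closed_E)
    then show False
      by (simp add: UN_E)
  qed
  then obtain n a where "a \<in> interior (E n)" by blast
  then obtain e where e: "e > 0" and ball: "cball a e \<subseteq> E n"
    by (metis mem_interior_cball)
  have "norm y \<le> 2 * real n / e" if y: "y \<in> F" for y
  proof (cases "y = 0")
    case False
    define b where "b = a + (e / norm y) *\<^sub>R y"
    have "a \<in> E n" "b \<in> E n"
      using ball e False by (auto simp: b_def dist_norm)
    then have "\<bar>inner a y\<bar> \<le> n" "\<bar>inner b y\<bar> \<le> n"
      using y by (auto simp: E_def)
    moreover have "inner b y = inner a y + e * norm y"
      using False by (simp add: b_def inner_add_left dot_square_norm power2_eq_square)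
    ultimately have "e * norm y \<le> 2 * real n" by linarith
    with e show ?thesis by (simp add: field_simps)
  qed (use e in simp)
  then show ?thesis
    by (rule boundedI)
qed

text \<open>
  If the range of \<open>T\<close> is closed, then \<open>S\<close> is bounded below on it: the vectors \<open>y\<close> of this range with
  \<open>norm (S y) \<le> 1\<close> satisfy \<open>\<bar>inner (T x) y\<bar> = \<bar>inner x (S y)\<bar> \<le> norm x\<close>, so they form a bounded set by
  uniform boundedness. Hence the image of this range under \<open>S\<close> is complete, and it is the whole
  range of \<open>S\<close> because \<open>S\<close> vanishes on the orthogonal complement.
\<close>
lemma closed_range_adjoint:
  fixes T :: "'a::{real_inner, complete_space} \<Rightarrow> 'b::{real_inner, complete_space}"
  assumes T: "bounded_linear T" and S: "bounded_linear S"
    and adj: "\<And>x y. inner (T x) y = inner x (S y)"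
    and cl: "closed (range T)"
  shows "closed (range S)"
proof -
  interpret S: bounded_linear S by fact
  have sub: "subspace (range T)"
    using T by (simp add: bounded_linear.linear linear_subspace_image subspace_UNIV)
  have complete_R: "complete (range T)"
    using cl by (simp add: complete_eq_closed)
  have decomp: "\<exists>u. \<forall>x. inner (z - T u) (T x) = 0" for z
    using orthogonal_projection_exists[OF sub complete_R, of z] by blast
  define F where "F = {y \<in> range T. norm (S y) \<le> 1}"
  have "bounded F"
  proof (rule uniform_boundedness_inner)
    fix z
    obtain u where u: "\<And>x. inner (z - T u) (T x) = 0" using decomp by blast
    have "\<bar>inner z y\<bar> \<le> norm u" if "y \<in> F" for y
    proof -
      from that have "inner (z - T u) y = 0" using u by (auto simp: F_def)
      then have "inner z y = inner u (S y)"
        by (simp add: inner_diff_left adj)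
      also have "\<bar>\<dots>\<bar> \<le> norm u * norm (S y)" by (rule Cauchy_Schwarz_ineq2)
      also have "\<dots> \<le> norm u * 1"
        using that by (intro mult_left_mono) (auto simp: F_def)
      finally show ?thesis by simp
    qed
    then show "\<exists>B. \<forall>y\<in>F. \<bar>inner z y\<bar> \<le> B" by blast
  qed
  then obtain C where C: "C > 0" "\<And>y. y \<in> F \<Longrightarrow> norm y \<le> C"
    by (auto simp: bounded_pos)
  have below: "inverse C * norm y \<le> norm (S y)" if y: "y \<in> range T" for y
  proof (cases "S y = 0")
    case True
    from y obtain x where "y = T x" by blast
    with True have "inner y y = 0" by (metis adj inner_zero_right)
    then show ?thesis by simp
  next
    case False
    have "inverse (norm (S y)) *\<^sub>R y \<in> F"
      using False y sub by (auto simp: F_def S.scaleR subspace_scale)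
    from C(2)[OF this] False C(1) show ?thesis by (simp add: field_simps)
  qed
  have "range S \<subseteq> S ` range T"
  proof
    fix v assume "v \<in> range S"
    then obtain y where v: "v = S y" by blast
    obtain u where u: "\<And>x. inner (y - T u) (T x) = 0" using decomp by blast
    have "inner (S (y - T u)) (S (y - T u)) = 0"
      using u by (metis adj inner_commute)
    then have "S y = S (T u)" by (simp add: S.diff)
    with v show "v \<in> S ` range T" by blast
  qed
  then have "range S = S ` range T" by blast
  moreover have "complete (S ` range T)"
    using C(1) below
    by (intro complete_isometric_image[of "inverse C"] sub S complete_R) auto
  ultimately show ?thesis by (simp add: complete_imp_closed)
qed

text \<open>
  The residual of \<open>x\<close> after projection to the range of \<open>S\<close> is orthogonal to this range, hence in the
  kernel of \<open>T\<close>, hence orthogonal to \<open>x\<close>; so it is orthogonal to itself.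
\<close>
lemma orthogonal_kernel_in_closed_range_adjoint:
  fixes T :: "'a::{real_inner, complete_space} \<Rightarrow> 'b::real_inner"
  assumes S: "bounded_linear S"
    and adj: "\<And>x y. inner (T x) y = inner x (S y)"
    and cl: "closed (range S)"
    and orth: "\<And>z. T z = 0 \<Longrightarrow> inner x z = 0"
  shows "x \<in> range S"
proof -
  have "subspace (range S)" "complete (range S)"
    using S cl by (auto simp: bounded_linear.linear linear_subspace_image subspace_UNIV
        complete_eq_closed)
  then obtain p where p: "p \<in> range S" "\<And>y. inner (x - p) (S y) = 0"
    using orthogonal_projection_exists[of "range S" x] by blast
  have "inner (T (x - p)) (T (x - p)) = 0"
    using p(2) adj by metis
  then have "inner x (x - p) = 0" using orth by simp
  moreover have "inner p (x - p) = 0" using p by (auto simp: inner_commute)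
  ultimately have "inner (x - p) (x - p) = 0"
    by (simp add: inner_diff_left)
  with p(1) show ?thesis by simp
qed

section \<open>Real structures and complex orthogonal projections\<close>

lemma csubspace_imp_subspace: "csubspace M \<Longrightarrow> subspace M"
  by (simp add: subspace_def complex_vector.subspace_def scaleR_eq_scaleC)

lemma Im_cinner: "Im (cinner x y) = inner (\<i> *\<^sub>C x) y"
  by (simp only: inner_eq_Re_cinner cinner_scaleC_left) simp

lemma cinner_eq_0_iff: "cinner x y = 0 \<longleftrightarrow> inner x y = 0 \<and> inner (\<i> *\<^sub>C x) y = 0"
  by (simp only: complex_eq_iff Im_cinner inner_eq_Re_cinner zero_complex.sel)

text \<open>A complex subspace is stable under \<open>\<i>\<close>, which turns imaginary parts into real ones.\<close>
lemma cperp_eq_inner: "csubspace M \<Longrightarrow> v \<in> cperp M \<longleftrightarrow> (\<forall>m\<in>M. inner m v = 0)"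
  using complex_vector.subspace_scale[of M]
  by (auto simp: cperp_def cinner_eq_0_iff)

lemma closed_cperp: "closed (cperp S)"
proof -
  have "cperp S = {v. \<forall>s\<in>S. inner s v = 0 \<and> inner (\<i> *\<^sub>C s) v = 0}"
    by (simp only: cperp_def cinner_eq_0_iff)
  moreover have "closed \<dots>"
    unfolding Ball_def
    by (intro closed_Collect_all closed_Collect_imp open_Collect_const closed_Collect_conj
        closed_Collect_eq continuous_intros)
  ultimately show ?thesis by simp
qed

context
  fixes c :: "'a::hermitian_space \<Rightarrow> 'a"
  assumes c: "real_structure c"
begin

lemma real_structure_involution: "c (c v) = v"
  using c by (simp add: real_structure_def)

lemma real_structure_cinner: "cinner (c v) (c w) = cnj (cinner v w)"
  using c by (simp add: real_structure_def)

lemma bounded_linear_real_structure: "bounded_linear c"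
proof (rule bounded_linear_intro)
  show "c (x + y) = c x + c y" for x y using c by (simp add: real_structure_def)
  show "c (r *\<^sub>R x) = r *\<^sub>R c x" for r x
    using c by (simp add: real_structure_def scaleR_eq_scaleC)
  show "norm (c x) \<le> norm x * 1" for x
    by (simp add: norm_eq_sqrt_inner inner_eq_Re_cinner real_structure_cinner)
qed

lemmas linear_real_structure = bounded_linear.linear[OF bounded_linear_real_structure]

lemma real_structure_image: "c ` S = c -` S"
proof
  show "c ` S \<subseteq> c -` S" by (simp add: image_subset_iff real_structure_involution)
  show "c -` S \<subseteq> c ` S"
    using real_structure_involution by (metis image_eqI subsetI vimageD)
qed

lemma closed_real_structure_image: "closed (c ` S) \<longleftrightarrow> closed S"
proof -
  have *: "closed (c ` S)" if "closed S" for S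
    using that bounded_linear_real_structure
    by (simp add: real_structure_image closed_vimage linear_continuous_on)
  have "c ` c ` S = S" by (simp add: real_structure_involution image_image)
  then show ?thesis using *[of S] *[of "c ` S"] by auto
qed

lemma real_structure_cperp: "c v \<in> cperp (c ` S) \<longleftrightarrow> v \<in> cperp S"
  by (simp add: cperp_def real_structure_cinner)

lemma csubspace_real_structure_image: "csubspace L \<Longrightarrow> csubspace (c ` L)"
proof -
  assume L: "csubspace L"
  have add: "c (x + y) = c x + c y" and scale: "c (a *\<^sub>C x) = cnj a *\<^sub>C c x" for x y a
    using c unfolding real_structure_def by blast+
  show ?thesis
    unfolding complex_vector.subspace_def real_structure_image vimage_eq add scale
      linear_0[OF linear_real_structure]
    using L unfolding complex_vector.subspace_def by blast
qed

lemma lagrangian_imp_closed: "lagrangian c L \<Longrightarrow> closed L"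
  using closed_cperp[of L] closed_real_structure_image[of L] by (simp add: lagrangian_def)

end

lemma orth_proj_unique:
  assumes M: "csubspace M" and "p \<in> M" "v - p \<in> cperp M"
  shows "orth_proj M v = p"
  unfolding orth_proj_def
proof (rule the_equality)
  fix q assume q: "q \<in> M \<and> v - q \<in> cperp M"
  have "q - p \<in> M" using q assms(2) complex_vector.subspace_diff[OF M] by simp
  then have "inner (q - p) (v - p) = 0" "inner (q - p) (v - q) = 0"
    using q assms(3) unfolding cperp_eq_inner[OF M] by simp_all
  then have "inner (q - p) (q - p) = 0" by (simp add: inner_diff_right)
  then show "q = p" by simp
qed (use assms in simp)

context
  fixes M :: "'a::{hermitian_space, complete_space} set"
  assumes M: "csubspace M" "closed M"
begin

lemma orth_proj_in: "orth_proj M v \<in> M"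
  and orth_proj_diff: "v - orth_proj M v \<in> cperp M"
proof -
  obtain p where "p \<in> M" "\<forall>m\<in>M. inner (v - p) m = 0"
    using orthogonal_projection_exists[of M v] M
    by (auto simp: csubspace_imp_subspace complete_eq_closed)
  then have "p \<in> M \<and> v - p \<in> cperp M"
    using M(1) by (simp add: cperp_eq_inner inner_commute)
  moreover from this have "orth_proj M v = p" using orth_proj_unique[OF M(1)] by simp
  ultimately show "orth_proj M v \<in> M" "v - orth_proj M v \<in> cperp M" by auto
qed

lemma inner_orth_proj: "m \<in> M \<Longrightarrow> inner m (orth_proj M v) = inner m v"
  using orth_proj_diff[of v] M(1) by (simp add: cperp_eq_inner inner_diff_right)

lemma orth_proj_self_adjoint: "inner (orth_proj M v) w = inner v (orth_proj M w)"
  using inner_orth_proj[OF orth_proj_in, of v w] inner_orth_proj[OF orth_proj_in, of w v]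
  by (metis inner_commute)

lemma orth_proj_id: "m \<in> M \<Longrightarrow> orth_proj M m = m"
  using M(1) by (intro orth_proj_unique) (simp_all add: cperp_eq_inner)

lemma bounded_linear_orth_proj: "bounded_linear (orth_proj M)"
proof (rule bounded_linear_intro)
  have sub: "subspace M" using M(1) by (rule csubspace_imp_subspace)
  show "orth_proj M (x + y) = orth_proj M x + orth_proj M y" for x y
    by (rule orth_proj_unique[OF M(1)])
      (simp_all add: cperp_eq_inner[OF M(1)] subspace_add[OF sub] orth_proj_in
        inner_diff_right inner_add_right inner_orth_proj)
  show "orth_proj M (r *\<^sub>R x) = r *\<^sub>R orth_proj M x" for r x
    by (rule orth_proj_unique[OF M(1)])
      (simp_all add: cperp_eq_inner[OF M(1)] subspace_scale[OF sub] orth_proj_in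
        inner_diff_right inner_orth_proj)
  show "norm (orth_proj M x) \<le> norm x * 1" for x
  proof (cases "orth_proj M x = 0")
    case False
    have "norm (orth_proj M x) * norm (orth_proj M x) = inner (orth_proj M x) x"
      using inner_orth_proj[OF orth_proj_in, of x x] by (simp flip: power2_norm_eq_inner add: power2_eq_square)
    also have "\<dots> \<le> norm (orth_proj M x) * norm x" by (rule norm_cauchy_schwarz)
    finally show ?thesis using False by simp
  qed simp
qed

lemma orth_proj_real_structure:
  assumes c: "real_structure c"
  shows "orth_proj (c ` M) (c v) = c (orth_proj M v)"
proof (rule orth_proj_unique)
  show "csubspace (c ` M)" using c M(1) by (rule csubspace_real_structure_image)
  show "c (orth_proj M v) \<in> c ` M" using orth_proj_in by blast
  have "c v - c (orth_proj M v) = c (v - orth_proj M v)"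
    using linear_diff[OF linear_real_structure[OF c]] by simp
  then show "c v - c (orth_proj M v) \<in> cperp (c ` M)"
    using orth_proj_diff by (simp add: real_structure_cperp[OF c])
qed

end

section \<open>Composition of Lagrangians\<close>

lemma csubspace_relcomp:
  assumes A: "csubspace A" and B: "csubspace B"
  shows "csubspace (A O B)"
  unfolding complex_vector.subspace_def
proof (intro conjI ballI allI)
  show "0 \<in> A O B"
    using complex_vector.subspace_0[OF A] complex_vector.subspace_0[OF B]
    by (auto simp: zero_prod_def)
  show "x + y \<in> A O B" if "x \<in> A O B" "y \<in> A O B" for x y
    using that complex_vector.subspace_add[OF A] complex_vector.subspace_add[OF B]
    by (fastforce simp: relcomp_unfold)
  show "a *\<^sub>C x \<in> A O B" if "x \<in> A O B" for a x
    using that complex_vector.subspace_scale[OF A, of _ a] complex_vector.subspace_scale[OF B, of _ a]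
    by (fastforce simp: relcomp_unfold scaleC_prod_def)
qed

text \<open>
  Since \<open>A\<close> and \<open>B\<close> contain the origin, orthogonality to their direct sum can be tested on each
  summand separately.
\<close>
lemma lagrangian_direct_sum:
  fixes A :: "('a::hermitian_space \<times> 'b::hermitian_space) set"
    and B :: "('c::hermitian_space \<times> 'd::hermitian_space) set"
  assumes A: "lagrangian (map_prod a b) A" and B: "lagrangian (map_prod c d) B"
  shows "lagrangian (map_prod a (map_prod b (map_prod c d)))
    {(u, v, w, x). (u, v) \<in> A \<and> (w, x) \<in> B}" (is "lagrangian ?c ?L")
  unfolding lagrangian_def
proof
  have subA: "csubspace A" and subB: "csubspace B"
    using A B by (auto simp: lagrangian_def)
  have A0: "(0, 0) \<in> A" and B0: "(0, 0) \<in> B"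
    using complex_vector.subspace_0[OF subA] complex_vector.subspace_0[OF subB]
    by (auto simp: zero_prod_def)
  show subL: "csubspace ?L"
    unfolding complex_vector.subspace_def
  proof (intro conjI ballI allI)
    show "0 \<in> ?L" by (simp add: zero_prod_def A0 B0)
    show "p + q \<in> ?L" if "p \<in> ?L" "q \<in> ?L" for p q
      using that complex_vector.subspace_add[OF subA, of "(fst p, fst (snd p))" "(fst q, fst (snd q))"]
        complex_vector.subspace_add[OF subB, of "snd (snd p)" "snd (snd q)"]
      by (simp add: case_prod_unfold)
    show "k *\<^sub>C p \<in> ?L" if "p \<in> ?L" for k p
      using that complex_vector.subspace_scale[OF subA, of "(fst p, fst (snd p))" k]
        complex_vector.subspace_scale[OF subB, of "snd (snd p)" k]
      by (simp add: case_prod_unfold scaleC_prod_def)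
  qed
  have perp: "(u, v, w, x) \<in> cperp ?L \<longleftrightarrow> (u, v) \<in> cperp A \<and> (w, x) \<in> cperp B" for u v w x
  proof
    assume L: "(u, v, w, x) \<in> cperp ?L"
    have "inner (p, q) (u, v) = 0" if "(p, q) \<in> A" for p q
      using L[unfolded cperp_eq_inner[OF subL], rule_format, of "(p, q, 0, 0)"] that B0 by simp
    moreover have "inner (p, q) (w, x) = 0" if "(p, q) \<in> B" for p q
      using L[unfolded cperp_eq_inner[OF subL], rule_format, of "(0, 0, p, q)"] that A0 by simp
    ultimately show "(u, v) \<in> cperp A \<and> (w, x) \<in> cperp B"
      unfolding cperp_eq_inner[OF subA] cperp_eq_inner[OF subB] by auto
  next
    assume "(u, v) \<in> cperp A \<and> (w, x) \<in> cperp B"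
    then have A: "\<forall>m\<in>A. inner m (u, v) = 0" and B: "\<forall>m\<in>B. inner m (w, x) = 0"
      unfolding cperp_eq_inner[OF subA] cperp_eq_inner[OF subB] by blast+
    have "inner (p, q, r, s) (u, v, w, x) = 0" if "(p, q) \<in> A" "(r, s) \<in> B" for p q r s
      using bspec[OF A that(1)] bspec[OF B that(2)] by simp
    then show "(u, v, w, x) \<in> cperp ?L"
      unfolding cperp_eq_inner[OF subL] by blast
  qed
  have "(u, v, w, x) \<in> ?c ` ?L \<longleftrightarrow> (u, v) \<in> map_prod a b ` A \<and> (w, x) \<in> map_prod c d ` B"
    for u v w x
    by (force simp: image_iff)
  then have "(u, v, w, x) \<in> ?c ` ?L \<longleftrightarrow> (u, v, w, x) \<in> cperp ?L" for u v w x
    using A B by (simp only: perp lagrangian_def)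
  then show "?c ` ?L = cperp ?L"
    by (intro set_eqI) (metis prod_cases4)
qed

lemma lagrangian_conj_mem_iff:
  assumes "real_structure c" "lagrangian c L"
  shows "c v \<in> L \<longleftrightarrow> v \<in> cperp L"
  using assms real_structure_image[OF assms(1), of L] by (auto simp: lagrangian_def)

text \<open>
  The real structure on the middle space enters the two relations with opposite signs, so in the sum
  of the two isotropy conditions its terms cancel.
\<close>
lemma relcomp_isotropic:
  fixes A :: "('a::hermitian_space \<times> 'b::hermitian_space) set"
    and B :: "('b \<times> 'c::hermitian_space) set"
  assumes A: "lagrangian (map_prod a (opposite b)) A" and B: "lagrangian (map_prod b (opposite c)) B"
  shows "map_prod a (opposite c) ` (A O B) \<subseteq> cperp (A O B)"
proof -
  have "cinner x' (a x) + cinner z' (- c z) = 0"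
    if h: "(x, y) \<in> A" "(y, z) \<in> B" "(x', y') \<in> A" "(y', z') \<in> B" for x y z x' y' z'
  proof -
    have "map_prod a (opposite b) (x, y) \<in> cperp A" "map_prod b (opposite c) (y, z) \<in> cperp B"
      using A B h unfolding lagrangian_def by blast+
    then have "cinner x' (a x) + cinner y' (- b y) = 0" "cinner y' (b y) + cinner z' (- c z) = 0"
      using h by (auto simp: cperp_def opposite_def cinner_prod_def)
    then show ?thesis by (simp add: cinner_minus_right)
  qed
  then show ?thesis
    by (auto simp: cperp_def cinner_prod_def opposite_def)
qed

theorem theorem2p11:
  fixes c0 :: "'a::{hermitian_space, complete_space} \<Rightarrow> 'a"
    and c1 :: "'b::{hermitian_space, complete_space} \<Rightarrow> 'b"
    and c2 :: "'c::{hermitian_space, complete_space} \<Rightarrow> 'c"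
    and cW :: "'a \<times> 'b \<times> 'b \<times> 'c \<Rightarrow> 'a \<times> 'b \<times> 'b \<times> 'c"
    and L01 :: "('a \<times> 'b) set" and L12 :: "('b \<times> 'c) set"
    and L U :: "('a \<times> 'b \<times> 'b \<times> 'c) set"
    and \<sigma> :: "'a \<times> 'b \<times> 'b \<times> 'c \<Rightarrow> 'b"
  assumes "real_structure c0" and "real_structure c1" and "real_structure c2"
    and "lagrangian (map_prod c0 (opposite c1)) L01"
    and "lagrangian (map_prod c1 (opposite c2)) L12"
    and "cW = map_prod c0 (map_prod (opposite c1) (map_prod c1 (opposite c2)))"
    and "L = {(v0, v1, v1', v2). (v0, v1) \<in> L01 \<and> (v1', v2) \<in> L12}"
    and "U = {(0, w, w, 0) | w. True}"
    and "\<sigma> = (\<lambda>(v0, v1, v1', v2). v1 - v1')"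
  shows "(closed (\<sigma> ` L) \<longleftrightarrow>
            closed (orth_proj L ` (cW ` U)) \<and> closed (orth_proj (cW ` L) ` U))
       \<and> (closed (\<sigma> ` L) \<longrightarrow>
            lagrangian (map_prod c0 (opposite c2)) (L01 O L12))"
proof -
  note c0 = assms(1) and c1 = assms(2) and c2 = assms(3) and lag01 = assms(4) and lag12 = assms(5)
  note cW_def = assms(6) and L_def = assms(7) and U_def = assms(8) and \<sigma>_def = assms(9)
  have cW: "real_structure cW"
    unfolding cW_def by (intro real_structure_map_prod real_structure_opposite c0 c1 c2)
  have lagL: "lagrangian cW L"
    unfolding cW_def L_def by (rule lagrangian_direct_sum[OF lag01 lag12])
  then have subL: "csubspace L" by (simp add: lagrangian_def)
  have closedL: "closed L" using cW lagL by (rule lagrangian_imp_closed)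
  note P = subL closedL

  define \<tau> :: "'b \<Rightarrow> 'a \<times> 'b \<times> 'b \<times> 'c" where "\<tau> w = (0, w, - w, 0)" for w
  define T where "T z = \<sigma> (orth_proj L z)" for z
  define S where "S w = orth_proj L (\<tau> w)" for w
  have lin_\<sigma>: "bounded_linear \<sigma>"
    unfolding \<sigma>_def case_prod_unfold
    by (intro bounded_linear_sub bounded_linear_fst_comp bounded_linear_snd_comp bounded_linear_ident)
  have lin_\<tau>: "bounded_linear \<tau>"
    unfolding \<tau>_def
    by (intro bounded_linear_Pair bounded_linear_minus bounded_linear_ident bounded_linear_zero)
  have T: "bounded_linear T"
    unfolding T_def by (rule bounded_linear_compose[OF lin_\<sigma> bounded_linear_orth_proj[OF P]])
  have S: "bounded_linear S"
    unfolding S_def by (rule bounded_linear_compose[OF bounded_linear_orth_proj[OF P] lin_\<tau>])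
  have adj: "inner (T z) w = inner z (S w)" for z w
  proof -
    have "inner (\<sigma> v) w = inner v (\<tau> w)" for v
      by (cases v) (simp add: \<sigma>_def \<tau>_def inner_diff_left)
    then show ?thesis
      by (simp add: T_def S_def orth_proj_self_adjoint[OF P])
  qed
  have "range (orth_proj L) = L"
    using orth_proj_in[OF P] orth_proj_id[OF P] by (metis image_subsetI rangeI subsetI subset_antisym)
  then have range_T: "range T = \<sigma> ` L"
    unfolding T_def by (metis image_image)
  have c1_minus: "c1 (- w) = - c1 w" for w
    by (rule linear_neg[OF linear_real_structure[OF c1]])
  have cW_U: "cW ` U = range \<tau>"
  proof -
    have [simp]: "c0 0 = 0" "c2 0 = 0"
      by (rule linear_0[OF linear_real_structure[OF c0]] linear_0[OF linear_real_structure[OF c2]])+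
    have "cW (0, w, w, 0) = \<tau> (- c1 w)" for w
      by (simp add: cW_def \<tau>_def opposite_def)
    then have "cW ` U \<subseteq> range \<tau>"
      unfolding U_def by auto
    moreover have "\<tau> w = cW (0, c1 (- w), c1 (- w), 0)" for w
      using real_structure_involution[OF c1] by (simp add: cW_def \<tau>_def opposite_def c1_minus)
    moreover have "(0, w, w, 0) \<in> U" for w
      unfolding U_def by blast
    ultimately show ?thesis
      by (metis (no_types, lifting) image_eqI image_subsetI subset_antisym)
  qed
  then have range_S: "range S = orth_proj L ` cW ` U"
    by (simp add: S_def image_image)
  have range_S': "cW ` range S = orth_proj (cW ` L) ` U"
    unfolding range_S image_image orth_proj_real_structure[OF P cW, symmetric]
    by (simp add: real_structure_involution[OF cW])

  have adj': "inner (S w) z = inner w (T z)" for z w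
    using adj by (metis inner_commute)
  have closed_iff: "closed (\<sigma> ` L) \<longleftrightarrow> closed (range S)"
    unfolding range_T[symmetric]
    using closed_range_adjoint[OF T S adj] closed_range_adjoint[OF S T adj'] by blast
  also have "\<dots> \<longleftrightarrow> closed (orth_proj L ` (cW ` U)) \<and> closed (orth_proj (cW ` L) ` U)"
    using closed_real_structure_image[OF cW, of "range S"]
    unfolding range_S'[symmetric] range_S[symmetric] by simp
  finally have equiv: "closed (\<sigma> ` L) \<longleftrightarrow>
    closed (orth_proj L ` (cW ` U)) \<and> closed (orth_proj (cW ` L) ` U)" .

  let ?c = "map_prod c0 (opposite c2)"
  have c02: "real_structure ?c"
    by (intro real_structure_map_prod real_structure_opposite c0 c2)
  have sub02: "csubspace (L01 O L12)"
    using lag01 lag12 by (intro csubspace_relcomp) (auto simp: lagrangian_def)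
  have coisotropic: "v \<in> ?c ` (L01 O L12)" if cl: "closed (\<sigma> ` L)" and v: "v \<in> cperp (L01 O L12)" for v
  proof -
    obtain x0 x2 where v_eq: "v = (x0, x2)" by (cases v)
    let ?x = "(x0, 0, 0, x2)"
    have "orth_proj L ?x \<in> range S"
    proof (rule orthogonal_kernel_in_closed_range_adjoint[OF S adj])
      show "closed (range S)" using cl closed_iff by simp
      fix z assume Tz: "T z = 0"
      obtain w0 w1 w1' w2 where w: "orth_proj L z = (w0, w1, w1', w2)"
        by (metis prod_cases4)
      have w1: "w1' = w1" using Tz by (simp add: T_def w \<sigma>_def)
      have "(w0, w1, w1', w2) \<in> L" using orth_proj_in[OF P, of z] unfolding w .
      then have "(w0, w2) \<in> L01 O L12"
        unfolding L_def w1 by auto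
      then have "inner (w0, w2) v = 0"
        using v sub02 by (simp add: cperp_eq_inner)
      then show "inner (orth_proj L ?x) z = 0"
        unfolding orth_proj_self_adjoint[OF P] w v_eq by (simp add: inner_commute)
    qed
    then obtain w where w: "orth_proj L ?x = orth_proj L (\<tau> w)"
      by (auto simp: S_def)
    have "orth_proj L (?x - \<tau> w) = 0"
      using w linear_diff[OF bounded_linear.linear[OF bounded_linear_orth_proj[OF P]]] by simp
    then have "?x - \<tau> w \<in> cperp L"
      using orth_proj_diff[OF P, of "?x - \<tau> w"] by simp
    then have "cW (?x - \<tau> w) \<in> L"
      using lagrangian_conj_mem_iff[OF cW lagL] by simp
    then have "(c0 x0, c1 w) \<in> L01" "(c1 w, - c2 x2) \<in> L12"
      by (auto simp: cW_def \<tau>_def L_def opposite_def c1_minus)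
    then have "?c v \<in> L01 O L12"
      by (auto simp: v_eq opposite_def)
    then show ?thesis
      using real_structure_image[OF c02] by blast
  qed
  have "lagrangian ?c (L01 O L12)" if "closed (\<sigma> ` L)"
    unfolding lagrangian_def
    using sub02 relcomp_isotropic[OF lag01 lag12] coisotropic[OF that] by blast
  with equiv show ?thesis by blast
qed

end
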